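(* Let $G=(V(G),E(G))$ be a finite graph, and let $q\ge 2$, $w\ge 0$ and $B\ge 0$ be real numbers. Then $$Z^{(2)}_G(q,w,B)\;\le\; Z_G(q,w,B)\;\le\; q^{\mathcal L(G)}\,Z^{(2)}_G(q,w,B),$$ where $$\mathcal L(G)=\max_{A\subseteq E(G)}\big|\{\text{connected components of } G_A=(V(G),A)\text{ containing a cycle}\}\big|$$ and $$Z^{(2)}_G(q,w,B)=\sum_{S\subseteq V(G)}(1+w)^{|E(S)|}\Big(1+\frac{w}{q-1}\Big)^{|E(V(G)\setminus S)|}\big((q-1)e^{-B}\big)^{|V(G)|-|S|}.$$
   Context: For $S\subseteq V(G)$, $E(S)$ denotes the set of edges of $G$ with both endpoints in $S$. For $\omega=(\omega_e)_{e\in E(G)}\in\{0,1\}^{E(G)}$, $\mathscr C(\omega)$ is the collection of connected components of the graph $(V(G),\{e:\omega_e=1\})$ (isolated vertices are components), and $|C|$ is the number of vertices of a component $C$. The random cluster partition function with external field $B$ is $$Z_G(q,w,B)=\sum_{\omega\in\{0,1\}^{E(G)}}\ \prod_{e\in E(G)}w^{\omega_e}\prod_{C\in\mathscr C(\omega)}\big(1+(q-1)e^{-B|C|}\big).$$ *)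

theory Defs
  imports Complex_Main "HOL-Library.FuncSet"
begin

text \<open>
  Undirected graphs in which loops (\<open>ends e = {v}\<close>) and parallel edges are permitted.
  A simple graph is the case where \<open>ends\<close> is injective on the edges and every \<open>ends e\<close>
  has two elements (for instance, edges that are two-element sets, with \<open>ends\<close> the identity).
\<close>

record ('v, 'e) ugraph =
  verts :: "'v set"
  edges :: "'e set"
  ends :: "'e \<Rightarrow> 'v set"

definition finite_graph :: "('v, 'e) ugraph \<Rightarrow> bool" where
  "finite_graph G \<longleftrightarrow> finite (verts G) \<and> finite (edges G) \<and>
     (\<forall>e\<in>edges G. ends G e \<subseteq> verts G \<and> card (ends G e) \<in> {1, 2})"

definition edges_in :: "('v, 'e) ugraph \<Rightarrow> 'v set \<Rightarrow> 'e set" where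
  "edges_in G S = {e \<in> edges G. ends G e \<subseteq> S}"

definition adjacency :: "('v, 'e) ugraph \<Rightarrow> 'e set \<Rightarrow> ('v \<times> 'v) set" where
  "adjacency G A = {(u, v). \<exists>e\<in>A. ends G e = {u, v}}"

text \<open>
  Vertex sets of the connected components of the spanning subgraph \<open>(verts G, A)\<close>;
  isolated vertices yield singleton components.
\<close>

definition components :: "('v, 'e) ugraph \<Rightarrow> 'e set \<Rightarrow> 'v set set" where
  "components G A = verts G // (adjacency G A)\<^sup>*"

text \<open>
  A cycle is given by distinct vertices \<open>v\<^sub>0, \<dots>, v\<^sub>n\<^sub>-\<^sub>1\<close> and distinct edges
  \<open>e\<^sub>0, \<dots>, e\<^sub>n\<^sub>-\<^sub>1\<close>, with \<open>n \<ge> 1\<close>, such that \<open>e\<^sub>i\<close> joins \<open>v\<^sub>i\<close> to its cyclic successor.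
  Length 1 is a loop, length 2 a pair of parallel edges; in a simple graph \<open>n \<ge> 3\<close> is forced.
\<close>

definition is_cycle :: "('v, 'e) ugraph \<Rightarrow> 'e set \<Rightarrow> 'v list \<Rightarrow> 'e list \<Rightarrow> bool" where
  "is_cycle G A vs es \<longleftrightarrow>
     vs \<noteq> [] \<and> length es = length vs \<and> distinct vs \<and> distinct es \<and> set es \<subseteq> A \<and>
     (\<forall>i<length vs. ends G (es ! i) = {vs ! i, vs ! (Suc i mod length vs)})"

definition contains_cycle :: "('v, 'e) ugraph \<Rightarrow> 'e set \<Rightarrow> 'v set \<Rightarrow> bool" where
  "contains_cycle G A C \<longleftrightarrow> (\<exists>vs es. is_cycle G A vs es \<and> set vs \<subseteq> C)"

definition max_cyclic_components :: "('v, 'e) ugraph \<Rightarrow> nat" where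
  "max_cyclic_components G =
     Max ((\<lambda>A. card {C \<in> components G A. contains_cycle G A C}) ` Pow (edges G))"

definition random_cluster_Z :: "('v, 'e) ugraph \<Rightarrow> real \<Rightarrow> real \<Rightarrow> real \<Rightarrow> real" where
  "random_cluster_Z G q w B =
     (\<Sum>\<omega>\<in>edges G \<rightarrow>\<^sub>E {0, 1 :: nat}.
        (\<Prod>e\<in>edges G. w ^ \<omega> e) *
        (\<Prod>C\<in>components G {e \<in> edges G. \<omega> e = 1}. 1 + (q - 1) * exp (- B * real (card C))))"

definition Z2 :: "('v, 'e) ugraph \<Rightarrow> real \<Rightarrow> real \<Rightarrow> real \<Rightarrow> real" where
  "Z2 G q w B =
     (\<Sum>S\<in>Pow (verts G).
        (1 + w) ^ card (edges_in G S) *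
        (1 + w / (q - 1)) ^ card (edges_in G (verts G - S)) *
        ((q - 1) * exp (- B)) ^ (card (verts G) - card S))"

end

theory Submission
  imports Defs
begin

text \<open>
  Both partition functions are sums over edge sets \<open>A\<close> of \<open>w\<close> to the power \<open>|A|\<close> times a product
  over the components \<open>C\<close> of the spanning subgraph \<open>(V, A)\<close>.  For the random cluster model this is
  the definition, with factor \<open>1 + (q - 1) exp (-B |C|)\<close>.  For \<open>Z2\<close> it is obtained by expanding
  the two powers \<open>(1 + w)\<close> and \<open>(1 + w / (q - 1))\<close> over edge subsets and exchanging the sums: for
  a given \<open>A\<close> the admissible \<open>S\<close> are those whose complement is a union of components of \<open>(V, A)\<close>,
  and summing over the choice of these components factorises into
  \<open>1 + (q - 1)^(|C| - e(C)) exp (-B |C|)\<close>, where \<open>e(C)\<close> is the number of edges of \<open>A\<close> inside \<open>C\<close>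
  and the exponent may be negative (lemma \<open>Z2_eq_sum_edge_sets\<close>).

  The two products are compared factor by factor.  A component is connected, so
  \<open>|C| - e(C) \<le> 1\<close> (lemma \<open>card_component_le\<close>), and \<open>q - 1 \<ge> 1\<close> gives the lower bound.  If \<open>C\<close>
  contains no cycle then also \<open>|C| - e(C) \<ge> 1\<close> (lemma \<open>acyclic_card_inner_edges\<close>), and the two
  factors agree.  If \<open>C\<close> contains a cycle, the random cluster factor is at most \<open>q\<close> because
  \<open>B \<ge> 0\<close>, while the other factor is at least \<open>1\<close>.  Hence the products differ by at most one factor
  \<open>q\<close> for each component that contains a cycle.
\<close>

section \<open>Edges and components\<close>

text \<open>
  The edges of \<open>A\<close> with both ends in \<open>S\<close>; for \<open>A = edges G\<close> these are \<open>edges_in G S\<close>.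
\<close>

definition inner_edges :: "('v, 'e) ugraph \<Rightarrow> 'e set \<Rightarrow> 'v set \<Rightarrow> 'e set" where
  "inner_edges G A S = {e \<in> A. ends G e \<subseteq> S}"

lemma finite_edge_set:
  assumes "finite_graph G" "A \<subseteq> edges G"
  shows "finite A"
  using assms by (auto simp: finite_graph_def intro: finite_subset)

lemma ends_eq_pair:
  assumes "finite_graph G" "e \<in> edges G"
  obtains u v where "u \<in> verts G" "v \<in> verts G" "ends G e = {u, v}"
proof -
  have sub: "ends G e \<subseteq> verts G" and "card (ends G e) = 1 \<or> card (ends G e) = 2"
    using assms by (auto simp: finite_graph_def)
  then obtain u v where "ends G e = {u, v}"
    by (metis card_1_singletonE card_2_iff insert_absorb2)
  with sub show ?thesis using that by auto
qed

lemma ends_nonempty: "finite_graph G \<Longrightarrow> e \<in> edges G \<Longrightarrow> ends G e \<noteq> {}"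
  by (erule ends_eq_pair) auto

lemma equiv_adjacency_rtrancl: "equiv UNIV ((adjacency G A)\<^sup>*)"
proof (rule equivI)
  have "sym (adjacency G A)"
    by (auto simp: sym_def adjacency_def insert_commute)
  then show "sym ((adjacency G A)\<^sup>*)" by (rule sym_rtrancl)
qed (auto simp: refl_rtrancl trans_rtrancl)

lemma component_subset_verts:
  assumes "finite_graph G" "A \<subseteq> edges G" "C \<in> components G A"
  shows "C \<subseteq> verts G"
proof -
  obtain v where v: "v \<in> verts G" "C = (adjacency G A)\<^sup>* `` {v}"
    using assms(3) by (auto simp: components_def elim: quotientE)
  have "adjacency G A `` verts G \<subseteq> verts G"
    using assms(1,2) unfolding adjacency_def finite_graph_def by blast
  then have "(adjacency G A)\<^sup>* `` verts G = verts G"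
    by (rule Image_closed_trancl)
  with v show ?thesis by blast
qed

lemma finite_components:
  assumes "finite_graph G"
  shows "finite (components G A)"
proof -
  have "components G A = (\<lambda>v. (adjacency G A)\<^sup>* `` {v}) ` verts G"
    by (auto simp: components_def quotient_def)
  then show ?thesis using assms by (simp add: finite_graph_def)
qed

lemma finite_component:
  assumes "finite_graph G" "A \<subseteq> edges G" "C \<in> components G A"
  shows "finite C"
  using component_subset_verts[OF assms] assms(1)
  by (auto simp: finite_graph_def intro: finite_subset)

lemma component_nonempty: "C \<in> components G A \<Longrightarrow> C \<noteq> {}"
  by (auto simp: components_def elim!: quotientE)

lemma components_disjoint:
  assumes "C \<in> components G A" "D \<in> components G A" "C \<noteq> D"
  shows "C \<inter> D = {}"
proof -
  have "components G A \<subseteq> UNIV // (adjacency G A)\<^sup>*"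
    by (auto simp: components_def quotient_def)
  then show ?thesis
    using quotient_disj[OF equiv_adjacency_rtrancl, of C G A D] assms by blast
qed

lemma Union_components:
  assumes "finite_graph G" "A \<subseteq> edges G"
  shows "\<Union>(components G A) = verts G"
proof
  show "\<Union>(components G A) \<subseteq> verts G"
    using component_subset_verts[OF assms] by blast
  show "verts G \<subseteq> \<Union>(components G A)"
    by (auto simp: components_def quotient_def)
qed

lemma edge_meeting_component:
  assumes "finite_graph G" "A \<subseteq> edges G" "C \<in> components G A" "e \<in> A" "ends G e \<inter> C \<noteq> {}"
  shows "ends G e \<subseteq> C"
proof -
  obtain x where C: "C = (adjacency G A)\<^sup>* `` {x}"
    using assms(3) by (auto simp: components_def elim: quotientE)
  obtain u v where uv: "ends G e = {u, v}"
    using ends_eq_pair assms by (metis subsetD)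
  have "(u, v) \<in> adjacency G A" "(v, u) \<in> adjacency G A"
    using uv assms(4) by (auto simp: adjacency_def insert_commute)
  with C uv assms(5) show ?thesis by (auto intro: rtrancl_into_rtrancl)
qed

text \<open>A connected graph has at least \<open>|C| - 1\<close> edges.\<close>

lemma card_component_le:
  assumes "finite_graph G" "A \<subseteq> edges G" "C \<in> components G A"
  shows "card C \<le> Suc (card (inner_edges G A C))"
proof -
  obtain v where C: "C = (adjacency G A)\<^sup>* `` {v}"
    using assms(3) by (auto simp: components_def elim: quotientE)
  have finC: "finite C" and finA: "finite A"
    using finite_component[OF assms] finite_edge_set[OF assms(1,2)] by auto
  \<comment> \<open>An inclusion-maximal \<open>X\<close> for which the bound holds is closed under adjacency, for an edge
      leaving \<open>X\<close> would allow one more vertex.\<close>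
  define \<X> where "\<X> = {X. v \<in> X \<and> X \<subseteq> C \<and> card X \<le> Suc (card (inner_edges G A X))}"
  have "finite \<X>"
    by (rule finite_subset[of _ "Pow C"]) (auto simp: \<X>_def finC)
  moreover have "{v} \<in> \<X>" by (auto simp: \<X>_def C)
  ultimately obtain X where X: "X \<in> \<X>" and max: "\<And>Y. Y \<in> \<X> \<Longrightarrow> X \<subseteq> Y \<Longrightarrow> X = Y"
    using finite_has_maximal[of \<X>] by blast
  have "C \<subseteq> X"
  proof (rule ccontr)
    assume "\<not> C \<subseteq> X"
    moreover have "C \<subseteq> X" if "adjacency G A `` X \<subseteq> X"
      using Image_closed_trancl[OF that] X unfolding \<X>_def C by blast
    ultimately obtain a b where ab: "(a, b) \<in> adjacency G A" "a \<in> X" "b \<notin> X" by blast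
    then obtain e where e: "e \<in> A" "ends G e = {a, b}" by (auto simp: adjacency_def)
    have "a \<in> C" using ab X by (auto simp: \<X>_def)
    then have b: "b \<in> C" using ab(1) unfolding C by (auto intro: rtrancl_into_rtrancl)
    have finX: "finite X" using X finC by (auto simp: \<X>_def intro: finite_subset)
    have fin: "finite (inner_edges G A Y)" for Y
      using finA by (simp add: inner_edges_def)
    have "insert e (inner_edges G A X) \<subseteq> inner_edges G A (insert b X)"
      using e ab by (auto simp: inner_edges_def)
    moreover have "e \<notin> inner_edges G A X" using e ab by (auto simp: inner_edges_def)
    ultimately have "Suc (card (inner_edges G A X)) \<le> card (inner_edges G A (insert b X))"
      using fin by (metis card_insert_disjoint card_mono)
    then have "insert b X \<in> \<X>"
      using X b ab finX by (auto simp: \<X>_def)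
    with max[of "insert b X"] ab show False by blast
  qed
  with X have "X = C" by (auto simp: \<X>_def)
  with X show ?thesis by (simp add: \<X>_def)
qed

section \<open>Vertex sets without a cycle\<close>

text \<open>
  A path with vertices \<open>vs\<close> and edges \<open>es\<close> from \<open>A\<close>, staying in the vertex set \<open>X\<close>; the vertices
  are distinct, which makes the edges distinct as well.
\<close>

definition is_path_in ::
    "('v, 'e) ugraph \<Rightarrow> 'e set \<Rightarrow> 'v set \<Rightarrow> 'v list \<Rightarrow> 'e list \<Rightarrow> bool" where
  "is_path_in G A X vs es \<longleftrightarrow>
     distinct vs \<and> length vs = Suc (length es) \<and> set vs \<subseteq> X \<and> set es \<subseteq> A \<and>
     (\<forall>i<length es. ends G (es ! i) = {vs ! i, vs ! Suc i})"

lemma is_path_in_Cons: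
  assumes "is_path_in G A X vs es" "e \<in> A" "ends G e = {u, hd vs}" "u \<in> X" "u \<notin> set vs"
  shows "is_path_in G A X (u # vs) (e # es)"
proof -
  have "vs \<noteq> []" using assms(1) by (auto simp: is_path_in_def)
  then show ?thesis
    using assms by (auto simp: is_path_in_def nth_Cons hd_conv_nth split: nat.split)
qed

lemma is_path_in_distinct_edges:
  assumes "is_path_in G A X vs es"
  shows "distinct es"
  unfolding distinct_conv_nth
proof (intro allI impI notI)
  fix i j assume ij: "i < length es" "j < length es" "i \<noteq> j" "es ! i = es ! j"
  then have "{vs ! i, vs ! Suc i} = {vs ! j, vs ! Suc j}"
    using assms by (metis is_path_in_def)
  then show False
    using ij assms by (auto simp: is_path_in_def doubleton_eq_iff nth_eq_iff_index_eq)
qed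

lemma loop_contains_cycle:
  assumes "e \<in> A" "ends G e = {v}" "v \<in> X"
  shows "contains_cycle G A X"
  unfolding contains_cycle_def is_cycle_def
  using assms by (intro exI[of _ "[v]"] exI[of _ "[e]"]) auto

text \<open>An edge from the first vertex back to the \<open>j\<close>-th one closes an initial segment of a path.\<close>

lemma closed_path_contains_cycle:
  assumes path: "is_path_in G A X vs es" and e: "e \<in> A" "ends G e = {vs ! 0, vs ! j}"
    and j: "0 < j" "j < length vs" and ne: "e \<noteq> es ! 0"
  shows "contains_cycle G A X"
proof -
  have dist: "distinct vs" and len: "length vs = Suc (length es)" and sub: "set vs \<subseteq> X" "set es \<subseteq> A"
    and nth: "\<And>i. i < length es \<Longrightarrow> ends G (es ! i) = {vs ! i, vs ! Suc i}"
    using path by (auto simp: is_path_in_def)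
  define us where "us = take (Suc j) vs"
  define fs where "fs = take j es @ [e]"
  have lenu: "length us = Suc j" and lenf: "length fs = Suc j"
    using j len by (auto simp: us_def fs_def)
  have "e \<notin> set (take j es)"
  proof
    assume "e \<in> set (take j es)"
    then obtain i where i: "i < j" "e = es ! i" using j len by (auto simp: in_set_conv_nth)
    then have "{vs ! i, vs ! Suc i} = {vs ! 0, vs ! j}" using nth[of i] e j len by auto
    then have "i = 0"
      using i j dist len by (auto simp: doubleton_eq_iff nth_eq_iff_index_eq)
    with i ne show False by simp
  qed
  then have "distinct fs"
    using is_path_in_distinct_edges[OF path] by (simp add: fs_def)
  moreover have "ends G (fs ! i) = {us ! i, us ! (Suc i mod length us)}" if "i < length us" for i
  proof (cases "i = j")
    case True
    then show ?thesis using e j len lenu by (auto simp: us_def fs_def nth_append)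
  next
    case False
    then have "i < j" using that lenu by simp
    then show ?thesis using nth[of i] j len lenu by (simp add: us_def fs_def nth_append)
  qed
  moreover have "set fs \<subseteq> A" using sub e by (auto simp: fs_def dest: in_set_takeD)
  moreover have "set us \<subseteq> X" using sub by (auto simp: us_def dest: in_set_takeD)
  moreover have "distinct us" using dist by (simp add: us_def)
  ultimately show ?thesis
    unfolding contains_cycle_def is_cycle_def using lenu lenf
    by (intro exI[of _ us] exI[of _ fs]) auto
qed

text \<open>Minimum degree two forces a cycle: close up a longest path at its first vertex.\<close>

lemma min_degree_two_contains_cycle:
  assumes "finite_graph G" "A \<subseteq> edges G" "finite X" "X \<noteq> {}"
    and deg: "\<And>v. v \<in> X \<Longrightarrow> \<exists>e f. e \<noteq> f \<and> {e, f} \<subseteq> inner_edges G A X \<and> v \<in> ends G e \<and> v \<in> ends G f"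
  shows "contains_cycle G A X"
proof -
  define P where "P n \<longleftrightarrow> (\<exists>vs es. is_path_in G A X vs es \<and> length vs = n)" for n
  obtain x where "x \<in> X" using assms(4) by blast
  then have "is_path_in G A X [x] []" by (simp add: is_path_in_def)
  then have P1: "P 1" unfolding P_def by fastforce
  have bound: "\<forall>n. P n \<longrightarrow> n \<le> card X"
    unfolding P_def is_path_in_def by (metis assms(3) card_mono distinct_card)
  obtain vs es where path: "is_path_in G A X vs es" and n: "length vs = Greatest P"
    using GreatestI_nat[of P, OF P1] bound unfolding P_def by metis
  have longest: "length us \<le> length vs" if "is_path_in G A X us fs" for us fs
    using Greatest_le_nat[of P "length us" "card X"] that bound n unfolding P_def by metis
  have vs: "vs \<noteq> []" "set vs \<subseteq> X" using path by (auto simp: is_path_in_def)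
  then have "hd vs \<in> X" by auto
  \<comment> \<open>If \<open>es\<close> is empty then \<open>es ! 0\<close> is unspecified; the edge \<open>e\<close> is then a loop, which is the case
      \<open>j = 0\<close> below.\<close>
  then obtain e where e: "e \<in> inner_edges G A X" "hd vs \<in> ends G e" "e \<noteq> es ! 0"
    using deg by (metis insert_subset)
  then obtain u where u: "ends G e = {u, hd vs}" "u \<in> X" "e \<in> A"
    using assms(1,2) ends_eq_pair[of G e] unfolding inner_edges_def
    by (smt (verit) insert_commute insert_iff mem_Collect_eq singletonD subset_iff)
  have "u \<in> set vs"
  proof (rule ccontr)
    assume "u \<notin> set vs"
    with is_path_in_Cons[OF path u(3,1,2)] longest show False by fastforce
  qed
  then obtain j where j: "j < length vs" "u = vs ! j" by (auto simp: in_set_conv_nth)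
  show ?thesis
  proof (cases "j = 0")
    case True
    then show ?thesis
      using loop_contains_cycle[of e A G u X] u j vs by (simp add: hd_conv_nth)
  next
    case False
    then show ?thesis
      using closed_path_contains_cycle[OF path u(3), of j] u j e vs
      by (simp add: hd_conv_nth insert_commute)
  qed
qed

lemma contains_cycle_mono:
  "contains_cycle G A X \<Longrightarrow> X \<subseteq> Y \<Longrightarrow> contains_cycle G A Y"
  unfolding contains_cycle_def by blast

text \<open>
  A forest on a nonempty vertex set has fewer edges than vertices; the induction removes a vertex
  of degree at most one.
\<close>

lemma acyclic_card_inner_edges:
  assumes "finite_graph G" "A \<subseteq> edges G" "finite X" "X \<noteq> {}" "\<not> contains_cycle G A X"
  shows "card (inner_edges G A X) < card X"
  using assms(3-5)
proof (induction "card X" arbitrary: X rule: less_induct)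
  case less
  have finA: "finite A" by (rule finite_edge_set[OF assms(1,2)])
  obtain v where v: "v \<in> X"
    "\<And>e f. e \<in> inner_edges G A X \<Longrightarrow> f \<in> inner_edges G A X \<Longrightarrow>
       v \<in> ends G e \<Longrightarrow> v \<in> ends G f \<Longrightarrow> e = f"
    using min_degree_two_contains_cycle[OF assms(1,2) less.prems(1,2)] less.prems(3)
    by (metis bot.extremum insert_subset)
  define D where "D = {e \<in> inner_edges G A X. v \<in> ends G e}"
  have finD: "finite D" using finA by (simp add: D_def inner_edges_def)
  have D1: "card D \<le> 1"
    using v(2) by (subst One_nat_def, subst card_le_Suc0_iff_eq[OF finD]) (auto simp: D_def)
  have split: "inner_edges G A X = inner_edges G A (X - {v}) \<union> D"
    by (auto simp: D_def inner_edges_def)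
  have cX: "card X = Suc (card (X - {v}))"
    using v less.prems(1) by (metis card_Suc_Diff1)
  show ?case
  proof (cases "X = {v}")
    case True
    have "inner_edges G A X = {}"
    proof (rule ccontr)
      assume "inner_edges G A X \<noteq> {}"
      then obtain e where e: "e \<in> A" "ends G e \<subseteq> {v}" using True by (auto simp: inner_edges_def)
      then have "ends G e = {v}"
        using ends_nonempty[OF assms(1), of e] assms(2) by (metis subsetD subset_singletonD)
      with e loop_contains_cycle[of e A G v X] v less.prems(3) show False by blast
    qed
    then show ?thesis using True by simp
  next
    case False
    have "card (inner_edges G A (X - {v})) < card (X - {v})"
    proof (rule less.hyps)
      show "X - {v} \<noteq> {}" using False v by blast
      show "\<not> contains_cycle G A (X - {v})"
        using less.prems(3) contains_cycle_mono[of G A "X - {v}" X] by blast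
    qed (use cX less.prems in auto)
    moreover have "card (inner_edges G A X) \<le> card (inner_edges G A (X - {v})) + card D"
      unfolding split by (rule card_Un_le)
    ultimately show ?thesis using D1 cX by linarith
  qed
qed

section \<open>Expansion over edge sets\<close>

lemma random_cluster_Z_eq_sum_edge_sets:
  assumes "finite_graph G"
  shows "random_cluster_Z G q w B =
    (\<Sum>A\<in>Pow (edges G). w ^ card A *
       (\<Prod>C\<in>components G A. 1 + (q - 1) * exp (- B * real (card C))))"
  unfolding random_cluster_Z_def
proof (rule sum.reindex_bij_witness
    [where j = "\<lambda>\<omega>. {e \<in> edges G. \<omega> e = 1}"
       and i = "\<lambda>A. \<lambda>e\<in>edges G. if e \<in> A then 1 else 0"])
  fix \<omega> assume \<omega>: "\<omega> \<in> edges G \<rightarrow>\<^sub>E {0, 1 :: nat}"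
  then show "(\<lambda>e\<in>edges G. if e \<in> {e \<in> edges G. \<omega> e = 1} then 1 else 0) = \<omega>"
    by (intro ext) (fastforce simp: PiE_iff extensional_def restrict_def)
  have fin: "finite (edges G)" using assms by (simp add: finite_graph_def)
  have "(\<Prod>e\<in>edges G. w ^ \<omega> e) = (\<Prod>e\<in>edges G. if \<omega> e = 1 then w else 1)"
    using \<omega> by (intro prod.cong) (auto simp: PiE_iff)
  also have "\<dots> = w ^ card {e \<in> edges G. \<omega> e = 1}"
    using prod.inter_filter[OF fin, of "\<lambda>_. w" "\<lambda>e. \<omega> e = 1"] by simp
  finally show "w ^ card {e \<in> edges G. \<omega> e = 1} *
      (\<Prod>C\<in>components G {e \<in> edges G. \<omega> e = 1}. 1 + (q - 1) * exp (- B * real (card C))) =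
      (\<Prod>e\<in>edges G. w ^ \<omega> e) *
      (\<Prod>C\<in>components G {e \<in> edges G. \<omega> e = 1}. 1 + (q - 1) * exp (- B * real (card C)))"
    by simp
qed auto

lemma sum_Pow_prod:
  fixes f :: "'a \<Rightarrow> 'b :: comm_ring_1"
  assumes "finite I"
  shows "(\<Sum>X\<in>Pow I. \<Prod>x\<in>X. f x) = (\<Prod>x\<in>I. 1 + f x)"
  using prod_add[OF assms, of f "\<lambda>_. 1"] by (simp add: add.commute)

text \<open>
  The edge sets \<open>A\<close> compatible with \<open>S\<close> have no edge between \<open>S\<close> and its complement; equivalently,
  the complement is a union of components of \<open>(verts G, A)\<close>.
\<close>

lemma bij_betw_complement_Union_components:
  assumes "finite_graph G" "A \<subseteq> edges G"
  shows "bij_betw (\<lambda>\<D>. verts G - \<Union>\<D>) (Pow (components G A))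
    {S \<in> Pow (verts G). A \<subseteq> edges_in G S \<union> edges_in G (verts G - S)}"
proof (rule bij_betw_byWitness[where f' = "\<lambda>S. {C \<in> components G A. C \<subseteq> verts G - S}"])
  note sub = component_subset_verts[OF assms] and edge = edge_meeting_component[OF assms]
  show "\<forall>\<D>\<in>Pow (components G A).
      {C \<in> components G A. C \<subseteq> verts G - (verts G - \<Union>\<D>)} = \<D>"
  proof (intro ballI equalityI subsetI)
    fix \<D> C assume \<D>: "\<D> \<in> Pow (components G A)"
      and C: "C \<in> {C \<in> components G A. C \<subseteq> verts G - (verts G - \<Union>\<D>)}"
    then obtain x D where "x \<in> C" "x \<in> D" "D \<in> \<D>" using component_nonempty[of C G A] by blast
    then show "C \<in> \<D>" using components_disjoint[of C G A D] C \<D> by blast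
  qed (use sub in blast)
  show "\<forall>S\<in>{S \<in> Pow (verts G). A \<subseteq> edges_in G S \<union> edges_in G (verts G - S)}.
      verts G - \<Union>{C \<in> components G A. C \<subseteq> verts G - S} = S"
  proof (intro ballI)
    fix S assume S: "S \<in> {S \<in> Pow (verts G). A \<subseteq> edges_in G S \<union> edges_in G (verts G - S)}"
    have closed: "adjacency G A `` (verts G - S) \<subseteq> verts G - S"
      using S unfolding adjacency_def edges_in_def by blast
    have "x \<in> \<Union>{C \<in> components G A. C \<subseteq> verts G - S}" if x: "x \<in> verts G - S" for x
    proof -
      have "(adjacency G A)\<^sup>* `` {x} \<subseteq> verts G - S"
        using Image_closed_trancl[OF closed] x by blast
      moreover have "(adjacency G A)\<^sup>* `` {x} \<in> components G A"
        using x by (auto simp: components_def quotient_def)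
      ultimately show ?thesis by blast
    qed
    then show "verts G - \<Union>{C \<in> components G A. C \<subseteq> verts G - S} = S" using S by blast
  qed
  show "(\<lambda>\<D>. verts G - \<Union>\<D>) ` Pow (components G A)
      \<subseteq> {S \<in> Pow (verts G). A \<subseteq> edges_in G S \<union> edges_in G (verts G - S)}"
  proof (intro image_subsetI, simp, intro conjI subsetI)
    fix \<D> e assume \<D>: "\<D> \<subseteq> components G A" and e: "e \<in> A"
    have eG: "e \<in> edges G" "ends G e \<subseteq> verts G"
      using e assms by (auto simp: finite_graph_def)
    show "e \<in> edges_in G (verts G - \<Union>\<D>) \<union> edges_in G (verts G - (verts G - \<Union>\<D>))"
    proof (cases "ends G e \<inter> \<Union>\<D> = {}")
      case True
      then show ?thesis using eG by (auto simp: edges_in_def)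
    next
      case False
      then obtain C where "C \<in> \<D>" "ends G e \<inter> C \<noteq> {}" by blast
      then have "ends G e \<subseteq> \<Union>\<D>" using edge[of C e] \<D> e by blast
      then show ?thesis using eG by (auto simp: edges_in_def)
    qed
  qed
qed auto

text \<open>
  The summand attached to \<open>A\<close> and \<open>S\<close>, when \<open>S\<close> is the complement of the union of a family
  \<open>\<D>\<close> of components, is a product over \<open>\<D>\<close>.  It is applied with \<open>c = 1 / (q - 1)\<close> and
  \<open>b = (q - 1) exp (-B)\<close>.
\<close>

lemma edge_weight_Union_components:
  fixes w c b :: real
  assumes "finite_graph G" "A \<subseteq> edges G" "\<D> \<subseteq> components G A"
  shows "(\<Prod>e\<in>A. if ends G e \<subseteq> verts G - \<Union>\<D> then w else w * c) * b ^ card (\<Union>\<D>) =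
    w ^ card A * (\<Prod>C\<in>\<D>. b ^ card C * c ^ card (inner_edges G A C))"
proof -
  have finA: "finite A" by (rule finite_edge_set[OF assms(1,2)])
  have fin\<D>: "finite \<D>" using finite_components[OF assms(1)] assms(3) by (rule rev_finite_subset)
  have disj: "C \<inter> D = {}" if "C \<in> \<D>" "D \<in> \<D>" "C \<noteq> D" for C D
    using components_disjoint[of C G A D] that assms(3) by blast
  have crossing: "(ends G e \<subseteq> verts G - \<Union>\<D>) \<longleftrightarrow> e \<notin> (\<Union>C\<in>\<D>. inner_edges G A C)"
    if e: "e \<in> A" for e
  proof -
    have eG: "e \<in> edges G" using e assms(2) by blast
    then have "ends G e \<noteq> {}" "ends G e \<subseteq> verts G"
      using ends_nonempty[OF assms(1)] assms(1) by (auto simp: finite_graph_def)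
    then show ?thesis
      using edge_meeting_component[OF assms(1,2) _ e] e assms(3) unfolding inner_edges_def by blast
  qed
  have card_edges: "card (\<Union>C\<in>\<D>. inner_edges G A C) = (\<Sum>C\<in>\<D>. card (inner_edges G A C))"
  proof (rule card_UN_disjoint[OF fin\<D>])
    show "\<forall>C\<in>\<D>. \<forall>D\<in>\<D>. C \<noteq> D \<longrightarrow> inner_edges G A C \<inter> inner_edges G A D = {}"
    proof (intro ballI impI, rule ccontr)
      fix C D assume CD: "C \<in> \<D>" "D \<in> \<D>" "C \<noteq> D"
        and "inner_edges G A C \<inter> inner_edges G A D \<noteq> {}"
      then obtain e where e: "e \<in> A" "ends G e \<subseteq> C \<inter> D" by (auto simp: inner_edges_def)
      have "ends G e \<noteq> {}" using ends_nonempty[OF assms(1), of e] e assms(2) by blast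
      with e disj[OF CD] show False by blast
    qed
  qed (simp add: inner_edges_def finA)
  have card_verts: "card (\<Union>\<D>) = (\<Sum>C\<in>\<D>. card C)"
  proof -
    have "\<forall>C\<in>\<D>. finite C" using finite_component[OF assms(1,2)] assms(3) by blast
    then show ?thesis using card_UN_disjoint[OF fin\<D>, of "\<lambda>C. C"] disj by simp
  qed
  have "(\<Prod>e\<in>A. if ends G e \<subseteq> verts G - \<Union>\<D> then w else w * c) =
      (\<Prod>e\<in>A. w * (if e \<in> (\<Union>C\<in>\<D>. inner_edges G A C) then c else 1))"
    using crossing by (intro prod.cong) auto
  also have "\<dots> = w ^ card A * (\<Prod>e\<in>A. if e \<in> (\<Union>C\<in>\<D>. inner_edges G A C) then c else 1)"
    by (simp only: prod.distrib prod_constant)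
  also have "(\<Prod>e\<in>A. if e \<in> (\<Union>C\<in>\<D>. inner_edges G A C) then c else 1) =
      (\<Prod>e\<in>A \<inter> (\<Union>C\<in>\<D>. inner_edges G A C). c)"
    using prod.inter_restrict[OF finA, of "\<lambda>_. c" "\<Union>C\<in>\<D>. inner_edges G A C"] by simp
  also have "A \<inter> (\<Union>C\<in>\<D>. inner_edges G A C) = (\<Union>C\<in>\<D>. inner_edges G A C)"
    by (auto simp: inner_edges_def)
  also have "(\<Prod>e\<in>(\<Union>C\<in>\<D>. inner_edges G A C). c) = (\<Prod>C\<in>\<D>. c ^ card (inner_edges G A C))"
    by (simp only: prod_constant card_edges power_sum)
  finally show ?thesis
    by (simp add: card_verts power_sum prod.distrib mult_ac)
qed

lemma Z2_eq_sum_edge_sets: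
  assumes "finite_graph G"
  shows "Z2 G q w B =
    (\<Sum>A\<in>Pow (edges G). w ^ card A *
       (\<Prod>C\<in>components G A.
          1 + ((q - 1) * exp (- B)) ^ card C * (1 / (q - 1)) ^ card (inner_edges G A C)))"
proof -
  define b where "b = (q - 1) * exp (- B)"
  define c where "c = 1 / (q - 1)"
  define weight where
    "weight S A = (\<Prod>e\<in>A. if ends G e \<subseteq> S then w else w * c) * b ^ card (verts G - S)" for S A
  have finV: "finite (verts G)" and finE: "finite (edges G)"
    using assms by (auto simp: finite_graph_def)
  have expand: "(1 + w) ^ card (edges_in G S) * (1 + w / (q - 1)) ^ card (edges_in G (verts G - S)) *
      b ^ (card (verts G) - card S) =
      (\<Sum>A\<in>{A \<in> Pow (edges G). A \<subseteq> edges_in G S \<union> edges_in G (verts G - S)}. weight S A)"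
    if S: "S \<in> Pow (verts G)" for S
  proof -
    let ?E = "edges_in G S" and ?F = "edges_in G (verts G - S)"
    let ?f = "\<lambda>e. if ends G e \<subseteq> S then w else w * c"
    have fin: "finite ?E" "finite ?F" using finE by (auto simp: edges_in_def)
    have notin: "\<not> ends G e \<subseteq> S" if "e \<in> ?F" for e
      using ends_nonempty[OF assms, of e] that unfolding edges_in_def by blast
    have "(\<Sum>A\<in>Pow (?E \<union> ?F). \<Prod>e\<in>A. ?f e) = (\<Prod>e\<in>?E \<union> ?F. 1 + ?f e)"
      using fin by (intro sum_Pow_prod) auto
    also have "\<dots> = (\<Prod>e\<in>?E. 1 + ?f e) * (\<Prod>e\<in>?F. 1 + ?f e)"
      using notin by (intro prod.union_disjoint fin) (auto simp: edges_in_def)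
    also have "(\<Prod>e\<in>?E. 1 + ?f e) = (\<Prod>e\<in>?E. 1 + w)"
      by (intro prod.cong) (auto simp: edges_in_def)
    also have "(\<Prod>e\<in>?F. 1 + ?f e) = (\<Prod>e\<in>?F. 1 + w / (q - 1))"
      using notin by (intro prod.cong) (auto simp: c_def)
    finally have "(\<Sum>A\<in>Pow (?E \<union> ?F). \<Prod>e\<in>A. ?f e) = (1 + w) ^ card ?E * (1 + w / (q - 1)) ^ card ?F"
      by simp
    moreover have "{A \<in> Pow (edges G). A \<subseteq> ?E \<union> ?F} = Pow (?E \<union> ?F)"
      by (auto simp: edges_in_def)
    moreover have "card (verts G - S) = card (verts G) - card S"
      using S finV by (intro card_Diff_subset) (auto intro: finite_subset)
    ultimately show ?thesis by (simp add: weight_def flip: sum_distrib_right)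
  qed
  have "Z2 G q w B = (\<Sum>S\<in>Pow (verts G).
      \<Sum>A\<in>{A \<in> Pow (edges G). A \<subseteq> edges_in G S \<union> edges_in G (verts G - S)}. weight S A)"
    unfolding Z2_def b_def[symmetric] by (intro sum.cong refl expand)
  also have "\<dots> = (\<Sum>A\<in>Pow (edges G).
      \<Sum>S\<in>{S \<in> Pow (verts G). A \<subseteq> edges_in G S \<union> edges_in G (verts G - S)}. weight S A)"
    by (rule sum.swap_restrict) (use finV finE in auto)
  also have "\<dots> = (\<Sum>A\<in>Pow (edges G). w ^ card A *
      (\<Prod>C\<in>components G A. 1 + b ^ card C * c ^ card (inner_edges G A C)))"
  proof (rule sum.cong[OF refl])
    fix A assume "A \<in> Pow (edges G)"
    then have A: "A \<subseteq> edges G" by simp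
    have "(\<Sum>S\<in>{S \<in> Pow (verts G). A \<subseteq> edges_in G S \<union> edges_in G (verts G - S)}. weight S A) =
        (\<Sum>\<D>\<in>Pow (components G A). weight (verts G - \<Union>\<D>) A)"
      by (rule sum.reindex_bij_betw[OF bij_betw_complement_Union_components[OF assms A], symmetric])
    also have "\<dots> = (\<Sum>\<D>\<in>Pow (components G A).
        w ^ card A * (\<Prod>C\<in>\<D>. b ^ card C * c ^ card (inner_edges G A C)))"
    proof (rule sum.cong[OF refl])
      fix \<D> assume "\<D> \<in> Pow (components G A)"
      then have \<D>: "\<D> \<subseteq> components G A" by simp
      then have "verts G - (verts G - \<Union>\<D>) = \<Union>\<D>"
        using Union_components[OF assms A] by blast
      then show "weight (verts G - \<Union>\<D>) A =
          w ^ card A * (\<Prod>C\<in>\<D>. b ^ card C * c ^ card (inner_edges G A C))"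
        unfolding weight_def using edge_weight_Union_components[OF assms A \<D>] by simp
    qed
    also have "\<dots> = w ^ card A *
        (\<Prod>C\<in>components G A. 1 + b ^ card C * c ^ card (inner_edges G A C))"
      by (simp add: sum_Pow_prod finite_components[OF assms] flip: sum_distrib_left)
    finally show "(\<Sum>S\<in>{S \<in> Pow (verts G). A \<subseteq> edges_in G S \<union> edges_in G (verts G - S)}. weight S A) =
        w ^ card A * (\<Prod>C\<in>components G A. 1 + b ^ card C * c ^ card (inner_edges G A C))" .
  qed
  finally show ?thesis by (simp only: b_def c_def)
qed

section \<open>Comparison of the component factors\<close>

lemma Z2_factor_le:
  fixes q B :: real
  assumes "q \<ge> 2" "n \<le> Suc m"
  shows "((q - 1) * exp (- B)) ^ n * (1 / (q - 1)) ^ m \<le> (q - 1) * exp (- B * real n)"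
proof -
  have "(q - 1) ^ n \<le> (q - 1) ^ Suc m" using assms by (intro power_increasing) auto
  then have "(q - 1) ^ n * (1 / (q - 1)) ^ m \<le> q - 1"
    using assms(1) by (simp add: power_divide divide_simps mult.commute)
  then have "(q - 1) ^ n * (1 / (q - 1)) ^ m * exp (- B * real n) \<le> (q - 1) * exp (- B * real n)"
    by (rule mult_right_mono) simp
  then show ?thesis
    by (simp add: power_mult_distrib exp_of_nat_mult[symmetric] mult_ac)
qed

lemma Z2_factor_ge:
  fixes q B :: real
  assumes "q \<ge> 2" "Suc m \<le> n"
  shows "(q - 1) * exp (- B * real n) \<le> ((q - 1) * exp (- B)) ^ n * (1 / (q - 1)) ^ m"
proof -
  have "(q - 1) ^ Suc m \<le> (q - 1) ^ n" using assms by (intro power_increasing) auto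
  then have "q - 1 \<le> (q - 1) ^ n * (1 / (q - 1)) ^ m"
    using assms(1) by (simp add: power_divide divide_simps mult.commute)
  then have "(q - 1) * exp (- B * real n) \<le> (q - 1) ^ n * (1 / (q - 1)) ^ m * exp (- B * real n)"
    by (rule mult_right_mono) simp
  then show ?thesis
    by (simp add: power_mult_distrib exp_of_nat_mult[symmetric] mult_ac)
qed

lemma card_cyclic_components_le:
  assumes "finite_graph G" "A \<subseteq> edges G"
  shows "card {C \<in> components G A. contains_cycle G A C} \<le> max_cyclic_components G"
  unfolding max_cyclic_components_def
  using assms by (intro Max_ge) (auto simp: finite_graph_def)

lemma prod_components_le:
  fixes q B :: real
  assumes G: "finite_graph G" and A: "A \<subseteq> edges G" and q: "q \<ge> 2" and B: "B \<ge> 0"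
  shows "(\<Prod>C\<in>components G A. 1 + (q - 1) * exp (- B * real (card C))) \<le>
    q ^ max_cyclic_components G *
    (\<Prod>C\<in>components G A.
       1 + ((q - 1) * exp (- B)) ^ card C * (1 / (q - 1)) ^ card (inner_edges G A C))"
    (is "_ \<le> _ * (\<Prod>C\<in>_. 1 + ?g C)")
proof -
  let ?h = "\<lambda>C. if contains_cycle G A C then q else 1"
  have g: "?g C \<ge> 0" for C using q by simp
  have fin: "finite (components G A)" by (rule finite_components[OF G])
  have "(\<Prod>C\<in>components G A. 1 + (q - 1) * exp (- B * real (card C))) \<le>
      (\<Prod>C\<in>components G A. ?h C * (1 + ?g C))"
  proof (intro prod_mono conjI)
    fix C assume C: "C \<in> components G A"
    show "0 \<le> 1 + (q - 1) * exp (- B * real (card C))" using q by (simp add: add_nonneg_nonneg)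
    show "1 + (q - 1) * exp (- B * real (card C)) \<le> ?h C * (1 + ?g C)"
    proof (cases "contains_cycle G A C")
      case True
      have "(q - 1) * exp (- B * real (card C)) \<le> (q - 1) * 1"
        using q B by (intro mult_left_mono) auto
      moreover have "q * 1 \<le> q * (1 + ?g C)"
        using q g[of C] by (intro mult_left_mono) auto
      ultimately show ?thesis using True by simp
    next
      case False
      have "card (inner_edges G A C) < card C"
        by (rule acyclic_card_inner_edges
            [OF G A finite_component[OF G A C] component_nonempty[OF C] False])
      then show ?thesis using False Z2_factor_ge[OF q] by (simp add: Suc_le_eq)
    qed
  qed
  also have "\<dots> = q ^ card {C \<in> components G A. contains_cycle G A C} *
      (\<Prod>C\<in>components G A. 1 + ?g C)"
    using prod.inter_filter[OF fin, of "\<lambda>_. q" "contains_cycle G A"] by (simp add: prod.distrib)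
  also have "\<dots> \<le> q ^ max_cyclic_components G * (\<Prod>C\<in>components G A. 1 + ?g C)"
    using q g by (intro mult_right_mono power_increasing card_cyclic_components_le[OF G A] prod_nonneg)
      (auto simp: add_nonneg_nonneg)
  finally show ?thesis .
qed

theorem theorem1p4:
  fixes G :: "('v, 'e) ugraph" and q w B :: real
  assumes "finite_graph G" and "q \<ge> 2" and "w \<ge> 0" and "B \<ge> 0"
  shows "Z2 G q w B \<le> random_cluster_Z G q w B \<and>
    random_cluster_Z G q w B \<le> q ^ max_cyclic_components G * Z2 G q w B"
proof
  show "Z2 G q w B \<le> random_cluster_Z G q w B"
    unfolding Z2_eq_sum_edge_sets[OF assms(1)] random_cluster_Z_eq_sum_edge_sets[OF assms(1)]
  proof (intro sum_mono mult_left_mono prod_mono conjI)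
    fix A C assume "A \<in> Pow (edges G)" "C \<in> components G A"
    then show "1 + ((q - 1) * exp (- B)) ^ card C * (1 / (q - 1)) ^ card (inner_edges G A C) \<le>
        1 + (q - 1) * exp (- B * real (card C))"
      using Z2_factor_le[OF assms(2) card_component_le[OF assms(1)]] by auto
  qed (use assms in \<open>auto simp: add_nonneg_nonneg\<close>)
  show "random_cluster_Z G q w B \<le> q ^ max_cyclic_components G * Z2 G q w B"
    unfolding Z2_eq_sum_edge_sets[OF assms(1)] random_cluster_Z_eq_sum_edge_sets[OF assms(1)]
      sum_distrib_left
  proof (rule sum_mono)
    fix A assume "A \<in> Pow (edges G)"
    then have A: "A \<subseteq> edges G" by simp
    show "w ^ card A * (\<Prod>C\<in>components G A. 1 + (q - 1) * exp (- B * real (card C))) \<le>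
        q ^ max_cyclic_components G * (w ^ card A * (\<Prod>C\<in>components G A.
          1 + ((q - 1) * exp (- B)) ^ card C * (1 / (q - 1)) ^ card (inner_edges G A C)))"
      using mult_left_mono[OF prod_components_le[OF assms(1) A assms(2,4)], of "w ^ card A"] assms(3)
      by (simp add: mult_ac)
  qed
qed

end
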